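(* Let $\mathbb{K}$ be an algebraically closed field, $q\in\mathbb{K}$ a primitive $l$-th root of unity with $l\ge3$, and $\underline{\mu}=(\mu_1,\mu_2,\mu_3)\in(\mathbb{K}^* )^3$. Let $l_1$ be the multiplicative order of $q^2$. Then the module $M_2(\underline{\mu})$ is a simple $\mathcal{A}$-module of dimension $l_1l$ over $\mathbb{K}$.
   Context: The quantum spatial ageing algebra $\mathcal{A}$ is the $\mathbb{K}$-algebra generated by $E,K,K^{-1},X,Y$ ($K^{-1}$ the inverse of $K$) with relations $$EK=q^{-2}KE,\quad XK=q^{-1}KX,\quad YK=qKY,\quad EX=qXE,\quad EY=X+q^{-1}YE,\quad XY=qYX.$$ Modules are right modules. We have $l_1=l$ if $l$ is odd and $l_1=l/2$ if $l$ is even. $M_2(\underline{\mu})$ has $\mathbb{K}$-basis $\{e(a_1,a_2): 0\le a_1\le l_1-1,\ 0\le a_2\le l-1\}$; in the first argument addition is modulo $l_1$, in the second modulo $l$. The action is: $e(a_1,a_2)X=\mu_1q^{-a_1+a_2}e(a_1,a_2)$, $e(a_1,a_2)K^{\pm1}=\mu_3^{\pm1}e(a_1,a_2\pm1)$, $e(0,a_2)E=0$, $e(a_1,a_2)E=-\mu_2^{-1}\mu_1q^{a_1+2a_2}\frac{q^{-2a_1}-1}{q^{-2}-1}e(a_1-1,a_2)$ for $a_1\neq0$. If $l$ is odd: $e(a_1,a_2)Y=\mu_2q^{-a_2}e(a_1+1,a_2)$. If $l$ is even: $e(a_1,a_2)Y=\mu_2q^{-a_2}e(a_1+1,a_2)$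 for $a_1\ne\frac l2-1$ and $e(\frac l2-1,a_2)Y=\mu_2q^{-a_2}e(0,\frac l2+a_2)$. *)

theory Defs
  imports
    "HOL-Library.Poly_Mapping"
    "HOL-Algebra.QuotRing"
    "HOL-Computational_Algebra.Polynomial"
begin

definition primitive_root_of_unity :: "nat \<Rightarrow> 'k::field \<Rightarrow> bool" where
  "primitive_root_of_unity n x \<longleftrightarrow>
     0 < n \<and> x ^ n = 1 \<and> (\<forall>m. 0 < m \<and> m < n \<longrightarrow> x ^ m \<noteq> 1)"

text \<open>Only meaningful for roots of unity; all other elements get an unspecified value.\<close>

definition mult_order :: "'k::field \<Rightarrow> nat" where
  "mult_order x = (LEAST n. 0 < n \<and> x ^ n = 1)"


text \<open>
  The free vector space on a type of basis elements consists of the finitely supported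
  functions; \<open>Poly_Mapping.single i 1\<close> is the basis element of index \<open>i\<close>.
\<close>

definition pm_scale :: "'k::field \<Rightarrow> ('i \<Rightarrow>\<^sub>0 'k) \<Rightarrow> ('i \<Rightarrow>\<^sub>0 'k)" where
  "pm_scale c f = Poly_Mapping.map (\<lambda>x. c * x) f"

lemma lookup_pm_scale [simp]: "Poly_Mapping.lookup (pm_scale c f) i = c * Poly_Mapping.lookup f i"
  by (auto simp: pm_scale_def Poly_Mapping.map.rep_eq when_def)

global_interpretation pm: vector_space pm_scale
  by unfold_locales (auto intro!: poly_mapping_eqI simp: lookup_add algebra_simps)

text \<open>The linear map sending the basis element of index \<open>i\<close> to \<open>b i\<close>.\<close>

definition lin_ext :: "('i \<Rightarrow> ('j \<Rightarrow>\<^sub>0 'k)) \<Rightarrow> ('i \<Rightarrow>\<^sub>0 'k) \<Rightarrow> ('j \<Rightarrow>\<^sub>0 'k::field)" where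
  "lin_ext b f = (\<Sum>i\<in>Poly_Mapping.keys f. pm_scale (Poly_Mapping.lookup f i) (b i))"


text \<open>
  With words as a monoid under concatenation, \<open>'g list \<Rightarrow>\<^sub>0 'k\<close> with the convolution product
  of \<open>Poly_Mapping\<close> is the free associative unital algebra on \<open>'g\<close>.
\<close>

instantiation list :: (type) monoid_add
begin

definition zero_list :: "'a list" where "zero_list = []"

definition plus_list :: "'a list \<Rightarrow> 'a list \<Rightarrow> 'a list" where "plus_list u v = u @ v"

instance by standard (simp_all add: zero_list_def plus_list_def)

end

definition free_algebra :: "('g list \<Rightarrow>\<^sub>0 'k::field) ring" where
  "free_algebra = \<lparr>carrier = UNIV, monoid.mult = (*), one = 1, zero = 0, add = (+)\<rparr>"

lemma ring_free_algebra: "ring (free_algebra :: ('g list \<Rightarrow>\<^sub>0 'k::field) ring)"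
proof (intro ringI abelian_groupI monoidI)
  fix f :: "'g list \<Rightarrow>\<^sub>0 'k"
  show "\<exists>g\<in>carrier free_algebra. g \<oplus>\<^bsub>free_algebra\<^esub> f = \<zero>\<^bsub>free_algebra\<^esub>"
    by (rule bexI[of _ "- f"]) (simp_all add: free_algebra_def)
qed (simp_all add: free_algebra_def algebra_simps)


locale k_algebra = ring A for A :: "('a, 'r) ring_scheme" (structure) +
  fixes \<iota> :: "'k::field \<Rightarrow> 'a"
  assumes scalar_closed: "\<iota> c \<in> carrier A"
    and scalar_one: "\<iota> 1 = \<one>"
    and scalar_add: "\<iota> (c + d) = \<iota> c \<oplus> \<iota> d"
    and scalar_mult: "\<iota> (c * d) = \<iota> c \<otimes> \<iota> d"
    and scalar_central: "a \<in> carrier A \<Longrightarrow> \<iota> c \<otimes> a = a \<otimes> \<iota> c"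

text \<open>
  The module is carried by a subspace \<open>V\<close> of an ambient vector space, whose scalar
  multiplication agrees on \<open>V\<close> with the action of the scalars of the algebra.
\<close>

locale right_module = k_algebra A \<iota> + vector_space scale
  for A :: "('a, 'r) ring_scheme" (structure) and \<iota> :: "'k::field \<Rightarrow> 'a"
    and scale :: "'k \<Rightarrow> 'v::ab_group_add \<Rightarrow> 'v" +
  fixes V :: "'v set" and act :: "'v \<Rightarrow> 'a \<Rightarrow> 'v"
  assumes carrier_subspace: "subspace V"
    and act_closed: "v \<in> V \<Longrightarrow> a \<in> carrier A \<Longrightarrow> act v a \<in> V"
    and act_add_left: "u \<in> V \<Longrightarrow> v \<in> V \<Longrightarrow> a \<in> carrier A \<Longrightarrow> act (u + v) a = act u a + act v a"
    and act_add_right: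
      "v \<in> V \<Longrightarrow> a \<in> carrier A \<Longrightarrow> b \<in> carrier A \<Longrightarrow> act v (a \<oplus> b) = act v a + act v b"
    and act_mult:
      "v \<in> V \<Longrightarrow> a \<in> carrier A \<Longrightarrow> b \<in> carrier A \<Longrightarrow> act v (a \<otimes> b) = act (act v a) b"
    and act_one: "v \<in> V \<Longrightarrow> act v \<one> = v"
    and act_scalar: "v \<in> V \<Longrightarrow> act v (\<iota> c) = scale c v"
begin

definition submodule :: "'v set \<Rightarrow> bool" where
  "submodule W \<longleftrightarrow> W \<subseteq> V \<and> subspace W \<and> (\<forall>w\<in>W. \<forall>a\<in>carrier A. act w a \<in> W)"

end

locale simple_right_module = right_module +
  assumes nonzero: "V \<noteq> {0}"
    and simple: "submodule W \<Longrightarrow> W = {0} \<or> W = V"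


datatype ageing_gen = genE | genK | genKinv | genX | genY

abbreviation wd :: "ageing_gen list \<Rightarrow> (ageing_gen list \<Rightarrow>\<^sub>0 'k::field)" where
  "wd w \<equiv> Poly_Mapping.single w 1"

definition ageing_relators :: "'k::field \<Rightarrow> (ageing_gen list \<Rightarrow>\<^sub>0 'k) set" where
  "ageing_relators q =
    { wd [genK, genKinv] - 1,
      wd [genKinv, genK] - 1,
      wd [genE, genK] - pm_scale (q powi (-2)) (wd [genK, genE]),
      wd [genX, genK] - pm_scale (q powi (-1)) (wd [genK, genX]),
      wd [genY, genK] - pm_scale q (wd [genK, genY]),
      wd [genE, genX] - pm_scale q (wd [genX, genE]),
      wd [genE, genY] - (wd [genX] + pm_scale (q powi (-1)) (wd [genY, genE])),
      wd [genX, genY] - pm_scale q (wd [genY, genX]) }"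

definition ageing_ideal :: "'k::field \<Rightarrow> (ageing_gen list \<Rightarrow>\<^sub>0 'k) set" where
  "ageing_ideal q = genideal free_algebra (ageing_relators q)"

definition ageing_algebra :: "'k::field \<Rightarrow> (ageing_gen list \<Rightarrow>\<^sub>0 'k) set ring" where
  "ageing_algebra q = free_algebra Quot ageing_ideal q"

definition ageing_class :: "'k::field \<Rightarrow> (ageing_gen list \<Rightarrow>\<^sub>0 'k) \<Rightarrow> (ageing_gen list \<Rightarrow>\<^sub>0 'k) set" where
  "ageing_class q f = ageing_ideal q +>\<^bsub>free_algebra\<^esub> f"

definition ageing_scalar :: "'k::field \<Rightarrow> 'k \<Rightarrow> (ageing_gen list \<Rightarrow>\<^sub>0 'k) set" where
  "ageing_scalar q c = ageing_class q (pm_scale c 1)"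


definition l_one :: "nat \<Rightarrow> nat" where
  "l_one l = (if odd l then l else l div 2)"

definition M2_index :: "nat \<Rightarrow> (int \<times> int) set" where
  "M2_index l = {0..<int (l_one l)} \<times> {0..<int l}"

type_synonym 'k M2_vec = "int \<times> int \<Rightarrow>\<^sub>0 'k"

definition M2_carrier :: "nat \<Rightarrow> 'k::field M2_vec set" where
  "M2_carrier l = {v. Poly_Mapping.keys v \<subseteq> M2_index l}"

definition M2_basis :: "nat \<Rightarrow> int \<Rightarrow> int \<Rightarrow> 'k::field M2_vec" where
  "M2_basis l a1 a2 = Poly_Mapping.single (a1 mod int (l_one l), a2 mod int l) 1"

text \<open>The image of a basis vector with index in \<open>M2_index l\<close> under a generator.\<close>

fun M2_gen :: "nat \<Rightarrow> 'k::field \<Rightarrow> 'k \<Rightarrow> 'k \<Rightarrow> 'k \<Rightarrow> ageing_gen \<Rightarrow> int \<times> int \<Rightarrow> 'k M2_vec" where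
  "M2_gen l q \<mu>1 \<mu>2 \<mu>3 genX (a1, a2) = pm_scale (\<mu>1 * q powi (- a1 + a2)) (M2_basis l a1 a2)"
| "M2_gen l q \<mu>1 \<mu>2 \<mu>3 genK (a1, a2) = pm_scale \<mu>3 (M2_basis l a1 (a2 + 1))"
| "M2_gen l q \<mu>1 \<mu>2 \<mu>3 genKinv (a1, a2) = pm_scale (inverse \<mu>3) (M2_basis l a1 (a2 - 1))"
| "M2_gen l q \<mu>1 \<mu>2 \<mu>3 genE (a1, a2) =
    (if a1 = 0 then 0
     else pm_scale (- inverse \<mu>2 * \<mu>1 * q powi (a1 + 2 * a2)
            * ((q powi (- 2 * a1) - 1) / (q powi (- 2) - 1))) (M2_basis l (a1 - 1) a2))"
| "M2_gen l q \<mu>1 \<mu>2 \<mu>3 genY (a1, a2) =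
    pm_scale (\<mu>2 * q powi (- a2))
      (if even l \<and> a1 = int l div 2 - 1 then M2_basis l 0 (int l div 2 + a2)
       else M2_basis l (a1 + 1) a2)"

text \<open>As the modules are right modules, the first letter of a word acts first.\<close>

definition M2_free_act ::
    "nat \<Rightarrow> 'k::field \<Rightarrow> 'k \<Rightarrow> 'k \<Rightarrow> 'k \<Rightarrow> 'k M2_vec \<Rightarrow> (ageing_gen list \<Rightarrow>\<^sub>0 'k) \<Rightarrow> 'k M2_vec" where
  "M2_free_act l q \<mu>1 \<mu>2 \<mu>3 v f =
     lin_ext (\<lambda>w. fold (\<lambda>g. lin_ext (M2_gen l q \<mu>1 \<mu>2 \<mu>3 g)) w v) f"

text \<open>
  All representatives of a coset act in the same way on \<open>M2_carrier l\<close>; see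
  \<open>M2_act_class\<close> below.
\<close>

definition M2_act ::
    "nat \<Rightarrow> 'k::field \<Rightarrow> 'k \<Rightarrow> 'k \<Rightarrow> 'k \<Rightarrow> 'k M2_vec \<Rightarrow> (ageing_gen list \<Rightarrow>\<^sub>0 'k) set \<Rightarrow> 'k M2_vec" where
  "M2_act l q \<mu>1 \<mu>2 \<mu>3 v C = the_elem (M2_free_act l q \<mu>1 \<mu>2 \<mu>3 v ` C)"


subsection \<open>The action is well defined\<close>

lemma lin_ext_superset:
  assumes "finite S" "Poly_Mapping.keys f \<subseteq> S"
  shows "lin_ext b f = (\<Sum>i\<in>S. pm_scale (Poly_Mapping.lookup f i) (b i))"
  unfolding lin_ext_def
  by (rule sum.mono_neutral_left) (use assms in \<open>auto simp: in_keys_iff\<close>)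

lemma lin_ext_add: "lin_ext b (f + g) = lin_ext b f + lin_ext b g"
proof -
  let ?S = "Poly_Mapping.keys f \<union> Poly_Mapping.keys g"
  have "Poly_Mapping.keys (f + g) \<subseteq> ?S" by (rule Poly_Mapping.keys_add)
  then show ?thesis
    by (simp add: lin_ext_superset[of ?S] lookup_add pm.scale_left_distrib sum.distrib)
qed

lemma lin_ext_scale: "lin_ext b (pm_scale c f) = pm_scale c (lin_ext b f)"
proof -
  have "Poly_Mapping.keys (pm_scale c f) \<subseteq> Poly_Mapping.keys f" by (auto simp: in_keys_iff)
  then show ?thesis
    by (simp add: lin_ext_superset[of "Poly_Mapping.keys f"] pm.scale_sum_right)
qed

lemma lin_ext_0 [simp]: "lin_ext b 0 = 0"
  by (simp add: lin_ext_def)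

lemma lin_ext_single [simp]: "lin_ext b (Poly_Mapping.single i c) = pm_scale c (b i)"
  by (simp add: lin_ext_def)

lemma lin_ext_minus: "lin_ext b (f - g) = lin_ext b f - lin_ext b g"
  using lin_ext_add[of b "f - g" g] by (simp add: algebra_simps)

lemma pm_decompose:
  fixes f :: "'i \<Rightarrow>\<^sub>0 'k::comm_monoid_add"
  shows "f = (\<Sum>i\<in>Poly_Mapping.keys f. Poly_Mapping.single i (Poly_Mapping.lookup f i))"
  by (rule poly_mapping_eqI) (auto simp: lookup_sum lookup_single when_def in_keys_iff sum.delta)

lemma pm_induct [case_names zero single add]:
  fixes f :: "'i \<Rightarrow>\<^sub>0 'k::comm_monoid_add"
  assumes "P 0" "\<And>i c. i \<in> Poly_Mapping.keys f \<Longrightarrow> P (Poly_Mapping.single i c)" "\<And>f g. P f \<Longrightarrow> P g \<Longrightarrow> P (f + g)"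
  shows "P f"
proof -
  have "P (\<Sum>i\<in>S. Poly_Mapping.single i (Poly_Mapping.lookup f i))" if "finite S" "S \<subseteq> Poly_Mapping.keys f" for S
    using that
  proof (induction S rule: finite_induct)
    case (insert i S)
    have "P (Poly_Mapping.single i (Poly_Mapping.lookup f i)
             + (\<Sum>i\<in>S. Poly_Mapping.single i (Poly_Mapping.lookup f i)))"
      by (intro assms(2,3)) (use insert in auto)
    then show ?case by (simp only: sum.insert[OF insert(1,2)])
  qed (simp add: assms(1))
  from this[OF finite_keys order.refl] show ?thesis by (simp only: pm_decompose [symmetric])
qed

context
  fixes l :: nat and q \<mu>1 \<mu>2 \<mu>3 :: "'k::field"
begin

abbreviation (input) ACT where "ACT \<equiv> M2_free_act l q \<mu>1 \<mu>2 \<mu>3"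
abbreviation (input) GEN where "GEN \<equiv> \<lambda>g. lin_ext (M2_gen l q \<mu>1 \<mu>2 \<mu>3 g)"

lemma fold_add: "fold GEN w (u + v) = fold GEN w u + fold GEN w v"
  by (induction w arbitrary: u v) (auto simp: lin_ext_add)

lemma fold_scale: "fold GEN w (pm_scale c v) = pm_scale c (fold GEN w v)"
  by (induction w arbitrary: v) (auto simp: lin_ext_scale)

lemma fold_0: "fold GEN w 0 = 0"
  using fold_scale[of w 0 0] by simp

lemma ACT_add_right: "ACT v (f + g) = ACT v f + ACT v g"
  by (simp add: M2_free_act_def lin_ext_add)

lemma ACT_minus_right: "ACT v (f - g) = ACT v f - ACT v g"
  by (simp add: M2_free_act_def lin_ext_minus)

lemma ACT_scale_right: "ACT v (pm_scale c f) = pm_scale c (ACT v f)"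
  by (simp add: M2_free_act_def lin_ext_scale)

lemma ACT_zero_right: "ACT v 0 = 0"
  by (simp add: M2_free_act_def)

lemma ACT_single: "ACT v (Poly_Mapping.single w c) = pm_scale c (fold GEN w v)"
  by (simp add: M2_free_act_def)

lemma ACT_one: "ACT v 1 = v"
  by (simp only: single_one [symmetric] ACT_single)
     (simp add: zero_list_def)

lemma ACT_add_left: "ACT (u + v) f = ACT u f + ACT v f"
  by (simp add: M2_free_act_def lin_ext_def fold_add pm.scale_right_distrib sum.distrib)

lemma ACT_scale_left: "ACT (pm_scale c v) f = pm_scale c (ACT v f)"
  by (simp add: M2_free_act_def lin_ext_def fold_scale pm.scale_sum_right mult.commute)

lemma ACT_zero_left: "ACT 0 f = 0"
  using ACT_scale_left[of 0 0 f] by simp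

lemma ACT_mult: "ACT v (f * g) = ACT (ACT v f) g"
proof (induction f rule: pm_induct)
  case (single w c)
  show ?case
  proof (induction g rule: pm_induct)
    case (single w' c')
    show ?case
      by (simp add: ACT_single mult_single plus_list_def fold_scale mult.commute)
  qed (simp_all add: ACT_add_right ACT_zero_right distrib_left)
qed (simp_all add: ACT_add_left ACT_add_right ACT_zero_left ACT_zero_right distrib_right)

context
  assumes l3: "3 \<le> l" and q: "primitive_root_of_unity l q"
    and mu: "\<mu>1 \<noteq> 0" "\<mu>2 \<noteq> 0" "\<mu>3 \<noteq> 0"
begin

lemma q_nz: "q \<noteq> 0"
  using q by (auto simp: primitive_root_of_unity_def zero_power)

lemma q_powi_l: "q powi int l = 1"
  using q by (simp add: primitive_root_of_unity_def)

lemma q2_nz: "q powi (-2) - 1 \<noteq> 0"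
proof -
  have "q ^ 2 \<noteq> 1" using q l3 by (simp add: primitive_root_of_unity_def)
  then show ?thesis using q_nz by (simp add: power_int_minus)
qed

lemma l_one_bounds: "0 < l_one l"
  using l3 by (auto simp: l_one_def)

lemma q_powi_half:
  assumes "even l"
  shows "q powi (int l div 2) = - 1"
proof -
  obtain h where h: "l = 2 * h" using assms by blast
  have "(q ^ h) ^ 2 = 1" "q ^ h \<noteq> 1"
    using q l3 h by (auto simp: primitive_root_of_unity_def power_mult mult.commute)
  then have "q ^ h = - 1" by (simp add: power2_eq_1_iff)
  then show ?thesis using h by simp
qed

lemma q_powi_mod: "q powi (a mod int l) = q powi a"
proof -
  have "q powi a = q powi (int l * (a div int l) + a mod int l)" by simp
  also have "\<dots> = q powi (a mod int l)"
    using q_nz by (subst power_int_add) (auto simp only: power_int_mult q_powi_l power_int_1_left mult_1_left)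
  finally show ?thesis by simp
qed

lemma q_powi_double_mod: "q powi (2 * (a mod int l)) = q powi (2 * a)"
  by (subst (1 2) mult.commute) (simp only: power_int_mult q_powi_mod)

lemma gen_keys:
  assumes "i \<in> M2_index l"
  shows "Poly_Mapping.keys (M2_gen l q \<mu>1 \<mu>2 \<mu>3 g i) \<subseteq> M2_index l"
proof -
  have b: "Poly_Mapping.keys (pm_scale c (M2_basis l a1 a2) :: 'k M2_vec) \<subseteq> M2_index l" for c a1 a2
    using l_one_bounds l3
    by (auto simp: in_keys_iff M2_basis_def M2_index_def lookup_single when_def split: if_splits)
  show ?thesis
    by (cases g; cases i) (use b in auto)
qed

lemma carrier_subspace: "pm.subspace (M2_carrier l :: 'k M2_vec set)"
proof -
  have "Poly_Mapping.keys (u + v) \<subseteq> M2_index l" if "Poly_Mapping.keys u \<subseteq> M2_index l" "Poly_Mapping.keys v \<subseteq> M2_index l"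
    for u v :: "'k M2_vec"
    using that Poly_Mapping.keys_add[of u v] by blast
  moreover have "Poly_Mapping.keys (pm_scale c u) \<subseteq> Poly_Mapping.keys u" for c and u :: "'k M2_vec"
    by (auto simp: in_keys_iff)
  ultimately show ?thesis
    by (intro pm.subspaceI; unfold M2_carrier_def mem_Collect_eq)
       (simp, assumption?, meson order.trans)
qed

lemma GEN_closed: "v \<in> M2_carrier l \<Longrightarrow> GEN g v \<in> M2_carrier l"
proof -
  assume "v \<in> M2_carrier l"
  then have "M2_gen l q \<mu>1 \<mu>2 \<mu>3 g i \<in> M2_carrier l" if "i \<in> Poly_Mapping.keys v" for i
    using gen_keys[of i] that by (auto simp: M2_carrier_def simp del: M2_gen.simps)
  then show ?thesis
    unfolding lin_ext_def
    by (intro pm.subspace_sum[OF carrier_subspace] pm.subspace_scale[OF carrier_subspace])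
qed

lemma ACT_closed: "v \<in> M2_carrier l \<Longrightarrow> ACT v f \<in> M2_carrier l"
proof -
  assume v: "v \<in> M2_carrier l"
  have "fold GEN w v \<in> M2_carrier l" for w
    using v by (induction w arbitrary: v) (auto simp: GEN_closed)
  then show ?thesis
    unfolding M2_free_act_def lin_ext_def
    by (intro pm.subspace_sum[OF carrier_subspace] pm.subspace_scale[OF carrier_subspace])
qed

lemma GEN_basis:
  assumes "0 \<le> a1" "a1 < int (l_one l)" "0 \<le> a2" "a2 < int l"
  shows "GEN g (M2_basis l a1 a2) = M2_gen l q \<mu>1 \<mu>2 \<mu>3 g (a1, a2)"
  using assms by (simp add: M2_basis_def del: M2_gen.simps)

lemma GEN_X:
  assumes "0 \<le> a1" "a1 < int (l_one l)"
  shows "GEN genX (M2_basis l a1 a2) = pm_scale (\<mu>1 * q powi (- a1 + a2)) (M2_basis l a1 a2)"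
proof -
  have "q powi (- a1 + a2 mod int l) = q powi (- a1 + a2)"
    using q_nz by (simp only: power_int_add q_powi_mod simp_thms)
  then show ?thesis using assms by (simp add: M2_basis_def)
qed

lemma GEN_K:
  assumes "0 \<le> a1" "a1 < int (l_one l)"
  shows "GEN genK (M2_basis l a1 a2) = pm_scale \<mu>3 (M2_basis l a1 (a2 + 1))"
  using assms by (simp add: M2_basis_def mod_simps)

lemma GEN_Kinv:
  assumes "0 \<le> a1" "a1 < int (l_one l)"
  shows "GEN genKinv (M2_basis l a1 a2) = pm_scale (inverse \<mu>3) (M2_basis l a1 (a2 - 1))"
  using assms by (simp add: M2_basis_def mod_simps)

definition E_coeff :: "int \<Rightarrow> int \<Rightarrow> 'k" where
  "E_coeff a1 a2 = - inverse \<mu>2 * \<mu>1 * q powi (a1 + 2 * a2)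
     * ((q powi (- 2 * a1) - 1) / (q powi (- 2) - 1))"

lemma GEN_E:
  assumes "0 \<le> a1" "a1 < int (l_one l)"
  shows "GEN genE (M2_basis l a1 a2) = pm_scale (E_coeff a1 a2) (M2_basis l (a1 - 1) a2)"
proof -
  have "q powi (a1 + 2 * (a2 mod int l)) = q powi (a1 + 2 * a2)"
    using q_nz by (simp add: power_int_add q_powi_double_mod)
  then show ?thesis
    using assms by (cases "a1 = 0") (simp_all add: M2_basis_def E_coeff_def)
qed

lemma E_coeff_0: "E_coeff 0 a2 = 0"
  by (simp add: E_coeff_def)

lemma E_coeff_shift: "E_coeff a1 (a2 + 1) = q powi 2 * E_coeff a1 a2"
proof -
  have "q powi (a1 + 2 * (a2 + 1)) = q powi 2 * q powi (a1 + 2 * a2)"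
    using q_nz power_int_mult[of q "a2 + 1" 2] power_int_mult[of q a2 2]
    by (simp add: power_int_add power_mult_distrib mult.commute)
  then show ?thesis by (simp add: E_coeff_def)
qed

lemma E_coeff_Suc:
  "E_coeff a1 a2 * (\<mu>2 * q powi (- a2)) =
     \<mu>1 * q powi (- a1 + a2) + q powi (-1) * (\<mu>2 * q powi (- a2) * E_coeff (a1 + 1) a2)"
proof -
  define u t D where "u = q powi a1" and "t = q powi a2" and "D = q powi (-2) - 1"
  have nz: "u \<noteq> 0" "t \<noteq> 0" "D \<noteq> 0" "q \<noteq> 0"
    using q_nz q2_nz by (simp_all add: u_def t_def D_def)
  have a: "q powi (- 2 * a) = inverse (q powi a) ^ 2" for a
    using power_int_mult[of q a "-2"] by (simp add: power_int_minus power_inverse mult.commute)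
  have b: "q powi (a + 2 * a2) = q powi a * t ^ 2" for a
    using q_nz power_int_mult[of q a2 2] by (simp add: power_int_add t_def mult.commute)
  have E1: "E_coeff a1 a2 = - inverse \<mu>2 * \<mu>1 * (u * t ^ 2) * ((inverse u ^ 2 - 1) / D)"
    by (simp only: E_coeff_def a b u_def D_def)
  have "q powi (a1 + 1) = u * q" using q_nz by (simp add: power_int_add u_def)
  then have E2: "E_coeff (a1 + 1) a2 =
      - inverse \<mu>2 * \<mu>1 * (u * q * t ^ 2) * ((inverse (u * q) ^ 2 - 1) / D)"
    by (simp only: E_coeff_def a b D_def)
  have D: "D * (y * (q * (q * x))) = y * x - y * (q * (q * x))" for x y
    using q_nz by (simp add: D_def power_int_minus power2_eq_square field_simps)
  have p: "q powi (- a2) = inverse t" "q powi (- a1 + a2) = t / u" "q powi (- 1) = inverse q"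
    using q_nz by (simp_all add: t_def u_def power_int_minus power_int_add power_int_diff)
  have "q ^ 2 * (E_coeff a1 a2 * (\<mu>2 * inverse t) * u * D) =
      q ^ 2 * ((\<mu>1 * (t / u) + inverse q * (\<mu>2 * inverse t * E_coeff (a1 + 1) a2)) * u * D)"
    unfolding E1 E2 using nz mu 
    by (simp add: divide_simps) (simp add: D power2_eq_square algebra_simps)
  then show ?thesis unfolding p using nz by simp
qed

lemma q_powi_minus_mod: "q powi (- (a mod int l)) = q powi (- a)"
  by (simp only: power_int_minus q_powi_mod)

lemma GEN_Y:
  assumes "0 \<le> a1" "a1 < int (l_one l) - 1"
  shows "GEN genY (M2_basis l a1 a2) = pm_scale (\<mu>2 * q powi (- a2)) (M2_basis l (a1 + 1) a2)"
  using assms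
  by (auto simp: M2_basis_def l_one_def q_powi_minus_mod mod_simps zdiv_int split: if_splits)

lemma GEN_Y_odd:
  assumes "odd l"
  shows "GEN genY (M2_basis l (int (l_one l) - 1) a2) =
    pm_scale (\<mu>2 * q powi (- a2)) (M2_basis l 0 a2)"
  using assms l3
  by (auto simp: M2_basis_def l_one_def q_powi_minus_mod mod_simps split: if_splits)

lemma GEN_Y_even:
  assumes "even l"
  shows "GEN genY (M2_basis l (int (l_one l) - 1) a2) =
    pm_scale (\<mu>2 * q powi (- a2)) (M2_basis l 0 (int l div 2 + a2))"
proof -
  have "(int l div 2 - 1) mod (int l div 2) = int l div 2 - 1"
    using assms l3 by (intro mod_pos_pos_trivial) auto
  then show ?thesis using assms
    by (simp add: M2_basis_def l_one_def q_powi_minus_mod zdiv_int mod_add_right_eq)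
qed

text \<open>The wrap-around step in both parities at once.\<close>

lemma GEN_Y_top:
  obtains s where "q powi s = q powi int (l_one l)"
    "\<And>a2. GEN genY (M2_basis l (int (l_one l) - 1) a2) =
      pm_scale (\<mu>2 * q powi (- a2)) (M2_basis l 0 (s + a2))"
proof (cases "even l")
  case True
  then show ?thesis
    by (intro that[of "int l div 2"] GEN_Y_even) (simp_all add: l_one_def zdiv_int)
next
  case False
  have "q powi 0 = q powi int (l_one l)"
    using False by (simp only: l_one_def q_powi_l if_True simp_thms power_int_0_right)
  then show ?thesis
    using False by (intro that[of 0]) (simp_all only: GEN_Y_odd add_0_left simp_thms)
qed

lemma q_powi_2_l_one: "q powi (2 * int (l_one l)) = 1"
proof (cases "even l")
  case True
  then show ?thesis
    using q_powi_l by (simp add: l_one_def zdiv_int)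
next
  case False
  have "q powi (2 * int l) = (q powi int l) powi 2"
    by (subst mult.commute) (simp only: power_int_mult)
  also have "\<dots> = 1" by (simp only: q_powi_l) simp
  finally show ?thesis using False by (simp only: l_one_def if_True simp_thms)
qed

lemma E_coeff_top: "E_coeff (int (l_one l)) a2 = 0"
proof -
  have "q powi (- 2 * int (l_one l)) = 1"
    using q_powi_2_l_one by (simp only: mult_minus_left power_int_minus inverse_1)
  then show ?thesis by (simp only: E_coeff_def) simp
qed

lemma l_one_ge_2: "2 \<le> l_one l"
  using l3 by (auto simp: l_one_def elim!: evenE)

lemma relator_kills_basis:
  assumes r: "r \<in> ageing_relators q" and a: "0 \<le> a1" "a1 < int (l_one l)"
  shows "ACT (M2_basis l a1 a2) r = 0"
proof -
  note simps = ACT_minus_right ACT_add_right ACT_scale_right ACT_single ACT_one lin_ext_scale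
    GEN_X GEN_K GEN_Kinv GEN_E
  note pow = power_int_add power_int_diff power_int_minus q_nz mu field_simps
  let ?B = "M2_basis l :: int \<Rightarrow> int \<Rightarrow> 'k M2_vec"
  have cong: "pm_scale c v = pm_scale d v" if "c = d" for c d and v :: "'k M2_vec"
    using that by simp
  obtain s where s: "q powi s = q powi int (l_one l)"
      "\<And>a2. GEN genY (?B (int (l_one l) - 1) a2) = pm_scale (\<mu>2 * q powi (- a2)) (?B 0 (s + a2))"
    by (rule GEN_Y_top) blast
  consider "r = wd [genK, genKinv] - 1" | "r = wd [genKinv, genK] - 1"
    | "r = wd [genE, genK] - pm_scale (q powi (-2)) (wd [genK, genE])"
    | "r = wd [genX, genK] - pm_scale (q powi (-1)) (wd [genK, genX])"
    | "r = wd [genY, genK] - pm_scale q (wd [genK, genY])"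
    | "r = wd [genE, genX] - pm_scale q (wd [genX, genE])"
    | "r = wd [genE, genY] - (wd [genX] + pm_scale (q powi (-1)) (wd [genY, genE]))"
    | "r = wd [genX, genY] - pm_scale q (wd [genY, genX])"
    using r unfolding ageing_relators_def by blast
  then show ?thesis
  proof cases
    case 1
    then show ?thesis using a mu by (simp add: simps)
  next
    case 2
    then show ?thesis using a mu by (simp add: simps)
  next
    case 3
    show ?thesis
    proof (cases "a1 = 0")
      case True
      then show ?thesis using 3 a by (simp add: simps E_coeff_0)
    next
      case False
      then show ?thesis using 3 a
        by (simp add: simps E_coeff_shift power_int_minus q_nz)
    qed
  next
    case 4
    then show ?thesis using a by (simp add: simps) (simp add: pow)
  next
    case 5
    show ?thesis
    proof (cases "a1 = int (l_one l) - 1")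
      case True
      then show ?thesis using 5 a l_one_bounds
        by (simp add: simps s(2) add.assoc) (simp add: pow)
    next
      case False
      then show ?thesis using 5 a
        by (simp add: simps GEN_Y) (simp add: pow)
    qed
  next
    case 6
    show ?thesis
    proof (cases "a1 = 0")
      case True
      then show ?thesis using 6 a by (simp add: simps E_coeff_0)
    next
      case False
      then show ?thesis using 6 a
        by (simp add: simps) (simp add: pow)
    qed
  next
    case 7
    have EY: "fold GEN [genE, genY] (?B a1 a2) =
        pm_scale (E_coeff a1 a2 * (\<mu>2 * q powi (- a2))) (?B a1 a2)"
    proof (cases "a1 = 0")
      case True
      then show ?thesis using a by (simp add: simps E_coeff_0)
    next
      case False
      then show ?thesis using a by (simp add: simps GEN_Y)
    qed
    have YE: "fold GEN [genY, genE] (?B a1 a2) =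
        pm_scale (\<mu>2 * q powi (- a2) * E_coeff (a1 + 1) a2) (?B a1 a2)"
    proof (cases "a1 = int (l_one l) - 1")
      case True
      then show ?thesis using a l_one_bounds
        by (simp add: simps s(2) E_coeff_0 E_coeff_top)
    next
      case False
      then show ?thesis using a by (simp add: simps GEN_Y)
    qed
    have X: "fold GEN [genX] (?B a1 a2) = pm_scale (\<mu>1 * q powi (- a1 + a2)) (?B a1 a2)"
      using a by (simp add: simps)
    show ?thesis
      unfolding 7 ACT_minus_right ACT_add_right ACT_scale_right ACT_single EY YE X E_coeff_Suc
      by (simp add: pm.scale_left_distrib)
  next
    case 8
    show ?thesis
    proof (cases "a1 = int (l_one l) - 1")
      case True
      have "q powi (- int (l_one l)) = q powi int (l_one l)"
        using q_powi_2_l_one power_int_add[of q "int (l_one l)" "int (l_one l)"] q_nz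
        by (simp only: mult_2 power_int_minus) (simp add: inverse_unique)
      then have "q powi (- a1 + a2) = q * q powi (s + a2)"
        using True s(1) q_nz by (simp add: power_int_add power_int_diff power_int_minus divide_inverse)
      then show ?thesis using 8 a True l_one_bounds
        by (simp add: simps s(2)) 
    next
      case False
      then show ?thesis using 8 a
        by (simp add: simps GEN_Y) (simp add: pow)
    qed
  qed
qed

lemma relator_kills:
  assumes r: "r \<in> ageing_relators q" and v: "v \<in> M2_carrier l"
  shows "ACT v r = 0"
proof (induction v rule: pm_induct)
  case (single i c)
  then have "i \<in> M2_index l" using v by (auto simp: M2_carrier_def)
  then obtain a1 a2 where i: "i = (a1, a2)" "0 \<le> a1" "a1 < int (l_one l)" "0 \<le> a2" "a2 < int l"
    by (auto simp: M2_index_def)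
  have "Poly_Mapping.single i c = pm_scale c (M2_basis l a1 a2)"
    using i by (intro poly_mapping_eqI) (simp add: M2_basis_def lookup_single when_def)
  then show ?case
    using relator_kills_basis[OF r i(2,3)] by (simp add: ACT_scale_left)
qed (simp_all add: ACT_zero_left ACT_add_left)

lemma ageing_ideal_kills:
  assumes f: "f \<in> ageing_ideal q" and v: "v \<in> M2_carrier l"
  shows "ACT v f = 0"
proof -
  let ?I = "{f. \<forall>v\<in>M2_carrier l. ACT v f = 0}"
  have "subgroup ?I (add_monoid free_algebra)"
  proof (rule group.subgroupI)
    show "Group.group (add_monoid (free_algebra :: (ageing_gen list \<Rightarrow>\<^sub>0 'k) ring))"
      by (rule abelian_group.a_group) (rule ring.is_abelian_group[OF ring_free_algebra])
    fix a assume a: "a \<in> ?I"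
    have "inv\<^bsub>add_monoid free_algebra\<^esub> a = - a"
      using ring_free_algebra a
      by (intro group.inv_equality abelian_group.a_group ring.is_abelian_group)
         (auto simp: free_algebra_def)
    then show "inv\<^bsub>add_monoid free_algebra\<^esub> a \<in> ?I"
      using a ACT_minus_right[of _ 0 a] by (simp add: ACT_zero_right)
  qed (auto simp: free_algebra_def ACT_add_right intro!: exI[of _ 0] ACT_zero_right)
  then have "ideal ?I free_algebra"
    by (rule idealI[OF ring_free_algebra])
       (auto simp: free_algebra_def ACT_mult ACT_closed ACT_zero_left)
  then have "ageing_ideal q \<subseteq> ?I"
    unfolding ageing_ideal_def
    by (rule ring.genideal_minimal[OF ring_free_algebra]) (auto simp: relator_kills)
  then show ?thesis using f v by blast
qed

theorem M2_act_class:
  assumes v: "v \<in> M2_carrier l"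
  shows "M2_act l q \<mu>1 \<mu>2 \<mu>3 v (ageing_class q f) = M2_free_act l q \<mu>1 \<mu>2 \<mu>3 v f"
proof -
  have c: "ageing_class q f = (\<lambda>h. h + f) ` ageing_ideal q"
    by (auto simp: ageing_class_def a_r_coset_def r_coset_def free_algebra_def)
  have "ageing_ideal q \<noteq> {}"
    unfolding ageing_ideal_def genideal_def
    using additive_subgroup.zero_closed[OF ideal.axioms(1)] by blast
  then have "ACT v ` ageing_class q f = {ACT v f}"
    using ageing_ideal_kills[OF _ v] by (auto simp: c image_image ACT_add_right)
  then show ?thesis by (simp add: M2_act_def)
qed

corollary M2_act_generator:
  assumes "0 \<le> a1" "a1 < int (l_one l)" "0 \<le> a2" "a2 < int l"
  shows "M2_act l q \<mu>1 \<mu>2 \<mu>3 (M2_basis l a1 a2) (ageing_class q (wd [g])) =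
    M2_gen l q \<mu>1 \<mu>2 \<mu>3 g (a1, a2)"
proof -
  have "M2_basis l a1 a2 \<in> (M2_carrier l :: 'k M2_vec set)"
    using assms by (simp add: M2_carrier_def M2_basis_def M2_index_def)
  then show ?thesis
    using assms by (simp add: M2_act_class ACT_single GEN_basis del: M2_gen.simps)
qed

end

end

end

theory Submission
  imports Defs
begin

text \<open>
  That \<open>M2_carrier l\<close> is a module follows from \<open>M2_act_class\<close>: the free algebra acts on it and
  the ideal of relations acts by zero, so the axioms transfer along the quotient map.  Its
  dimension is the number of basis indices, and \<open>l_one l\<close> is the order of \<open>q\<^sup>2\<close> because
  \<open>l\<close> divides \<open>2 * n\<close> exactly if \<open>l_one l\<close> divides \<open>n\<close>.

  For simplicity, look at the two elements \<open>X\<close> and \<open>X + (q\<^sup>-\<^sup>2 - 1) E Y\<close>.  Both act diagonally, with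
  eigenvalues \<open>\<mu>1 q\<^bsup>a2 - a1\<^esup>\<close> and \<open>\<mu>1 q\<^bsup>a2 + a1\<^esup>\<close> on \<open>e(a1, a2)\<close>.  The quotient of the two eigenvalues
  is \<open>q\<^bsup>2 a1\<^esup>\<close>, which determines \<open>a1\<close> modulo the order of \<open>q\<^sup>2\<close>, and then \<open>a2\<close> is determined modulo
  \<open>l\<close>: no two basis vectors have the same pair of eigenvalues (\<open>weights_separate\<close>).
  A nonzero submodule therefore contains a basis vector (\<open>basis_vector_in_subspace\<close>).  Up to
  nonzero factors, \<open>K\<close> moves the second index cyclically, while \<open>Y\<close> raises the first index and
  returns to \<open>0\<close> from the top, so this vector generates all the others
  (\<open>basis_vectors_generate\<close>).
\<close>

section \<open>The ageing algebra as an algebra over the field\<close>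

lemma ideal_ageing_ideal: "ideal (ageing_ideal q) free_algebra"
  unfolding ageing_ideal_def
  by (rule ring.genideal_ideal[OF ring_free_algebra]) (simp add: free_algebra_def)

lemma ring_hom_ageing_class:
  "ring_hom_ring free_algebra (ageing_algebra q) (ageing_class q)"
proof -
  have "ageing_class q = (+>\<^bsub>free_algebra\<^esub>) (ageing_ideal q)"
    by (rule ext) (simp add: ageing_class_def)
  then show ?thesis
    using ideal.rcos_ring_hom_ring[OF ideal_ageing_ideal] by (simp add: ageing_algebra_def)
qed

lemma carrier_ageing_algebra: "carrier (ageing_algebra q) = range (ageing_class q)"
  by (auto simp: ageing_algebra_def FactRing_def A_RCOSETS_def RCOSETS_def ageing_class_def
      a_r_coset_def free_algebra_def)

lemma ageing_class_ops:
  shows "ageing_class q f \<oplus>\<^bsub>ageing_algebra q\<^esub> ageing_class q g = ageing_class q (f + g)"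
    and "ageing_class q f \<otimes>\<^bsub>ageing_algebra q\<^esub> ageing_class q g = ageing_class q (f * g)"
    and "\<one>\<^bsub>ageing_algebra q\<^esub> = ageing_class q 1"
proof -
  interpret ring_hom_ring free_algebra "ageing_algebra q" "ageing_class q"
    by (rule ring_hom_ageing_class)
  show "ageing_class q f \<oplus>\<^bsub>ageing_algebra q\<^esub> ageing_class q g = ageing_class q (f + g)"
    using hom_add[of f g] by (simp add: free_algebra_def)
  show "ageing_class q f \<otimes>\<^bsub>ageing_algebra q\<^esub> ageing_class q g = ageing_class q (f * g)"
    using hom_mult[of f g] by (simp add: free_algebra_def)
  show "\<one>\<^bsub>ageing_algebra q\<^esub> = ageing_class q 1"
    using hom_one by (simp add: free_algebra_def)
qed

lemma scalar_times:
  fixes f :: "'g list \<Rightarrow>\<^sub>0 'k::field"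
  shows "pm_scale c 1 * f = pm_scale c f" and "f * pm_scale c 1 = pm_scale c f"
proof -
  have s: "pm_scale c (Poly_Mapping.single i d) = Poly_Mapping.single i (c * d)"
    for i :: "'g list" and d
    by (rule poly_mapping_eqI) (simp add: lookup_single when_def)
  have one: "pm_scale c (1 :: 'g list \<Rightarrow>\<^sub>0 'k) = Poly_Mapping.single 0 c"
    by (simp only: single_one [symmetric] s) simp
  show "pm_scale c 1 * f = pm_scale c f"
    by (induction f rule: pm_induct)
       (simp_all add: one mult_single s distrib_left pm.scale_right_distrib)
  show "f * pm_scale c 1 = pm_scale c f"
    by (induction f rule: pm_induct)
       (simp_all add: one mult_single s distrib_right pm.scale_right_distrib mult.commute)
qed

lemma k_algebra_ageing_algebra: "k_algebra (ageing_algebra q) (ageing_scalar q)"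
proof -
  interpret ring_hom_ring free_algebra "ageing_algebra q" "ageing_class q"
    by (rule ring_hom_ageing_class)
  show ?thesis
  proof unfold_locales
    fix c d
    show "ageing_scalar q c \<in> carrier (ageing_algebra q)"
      by (simp add: ageing_scalar_def carrier_ageing_algebra)
    show "ageing_scalar q 1 = \<one>\<^bsub>ageing_algebra q\<^esub>"
      by (simp add: ageing_scalar_def ageing_class_ops)
    show "ageing_scalar q (c + d) = ageing_scalar q c \<oplus>\<^bsub>ageing_algebra q\<^esub> ageing_scalar q d"
      by (simp add: ageing_scalar_def ageing_class_ops pm.scale_left_distrib)
    show "ageing_scalar q (c * d) = ageing_scalar q c \<otimes>\<^bsub>ageing_algebra q\<^esub> ageing_scalar q d"
      by (simp add: ageing_scalar_def ageing_class_ops scalar_times(1))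
    show "ageing_scalar q c \<otimes>\<^bsub>ageing_algebra q\<^esub> a = a \<otimes>\<^bsub>ageing_algebra q\<^esub> ageing_scalar q c"
      if "a \<in> carrier (ageing_algebra q)" for a
      using that by (auto simp: ageing_scalar_def carrier_ageing_algebra ageing_class_ops scalar_times)
  qed
qed

section \<open>Free vector spaces\<close>

lemma pm_span_singles:
  "pm.span ((\<lambda>i. Poly_Mapping.single i 1) ` I) = {v :: 'i \<Rightarrow>\<^sub>0 'k::field. Poly_Mapping.keys v \<subseteq> I}"
    (is "pm.span ?B = ?V")
proof
  have add: "Poly_Mapping.keys (u + v) \<subseteq> I" if "u \<in> ?V" "v \<in> ?V" for u v
    using that Poly_Mapping.keys_add[of u v] by blast
  have scale: "Poly_Mapping.keys (pm_scale c u) \<subseteq> Poly_Mapping.keys u" for c and u :: "'i \<Rightarrow>\<^sub>0 'k"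
    by (auto simp: in_keys_iff)
  have "pm.subspace ?V"
  proof (rule pm.subspaceI)
    show "0 \<in> ?V" by simp
    show "u + v \<in> ?V" if "u \<in> ?V" "v \<in> ?V" for u v
      using add[OF that] by simp
    show "pm_scale c u \<in> ?V" if "u \<in> ?V" for c u
      using scale[of c u] that by blast
  qed
  moreover have "?B \<subseteq> ?V" by auto
  ultimately show "pm.span ?B \<subseteq> ?V"
    by (rule pm.span_minimal[rotated])
next
  show "?V \<subseteq> pm.span ?B"
  proof
    fix v assume v: "v \<in> ?V"
    show "v \<in> pm.span ?B"
    proof (induction v rule: pm_induct)
      case (single i c)
      have "pm_scale c (Poly_Mapping.single i 1) = Poly_Mapping.single i c"
        by (rule poly_mapping_eqI) (simp add: lookup_single when_def)
      moreover have "Poly_Mapping.single i 1 \<in> pm.span ?B"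
        using single v by (intro pm.span_base) auto
      ultimately show ?case
        using pm.span_scale[of "Poly_Mapping.single i 1" ?B c] by simp
    qed (rule pm.span_zero, rule pm.span_add)
  qed
qed

lemma pm_independent_singles:
  "pm.independent ((\<lambda>i. Poly_Mapping.single i (1::'k::field)) ` I)"
proof
  assume "pm.dependent ((\<lambda>i. Poly_Mapping.single i (1::'k)) ` I)"
  then obtain i where i: "i \<in> I"
    "Poly_Mapping.single i (1::'k) \<in> pm.span ((\<lambda>i. Poly_Mapping.single i 1) ` I - {Poly_Mapping.single i 1})"
    unfolding pm.dependent_def by blast
  have "(\<lambda>i. Poly_Mapping.single i (1::'k)) ` I - {Poly_Mapping.single i 1}
      \<subseteq> (\<lambda>i. Poly_Mapping.single i 1) ` (I - {i})"
    by auto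
  from pm.span_mono[OF this] i(2) show False
    by (auto simp: pm_span_singles)
qed

lemma pm_dim_keys_subset:
  "pm.dim {v :: 'i \<Rightarrow>\<^sub>0 'k::field. Poly_Mapping.keys v \<subseteq> I} = card I"
proof -
  have "inj_on (\<lambda>i. Poly_Mapping.single i (1::'k)) I"
    by (rule inj_onI) (auto simp: poly_mapping_eq_iff fun_eq_iff lookup_single when_def split: if_splits)
  then show ?thesis
    by (simp only: pm_span_singles [symmetric] pm.dim_span
        pm.dim_eq_card_independent[OF pm_independent_singles] card_image)
qed

text \<open>
  The usual shortest-support argument: if two indices \<open>i \<noteq> j\<close> occur in \<open>w\<close>, some diagonal
  operator has different eigenvalues there, and subtracting the eigenvalue at \<open>i\<close> from it removes
  \<open>i\<close> from the support of \<open>w\<close> but keeps \<open>j\<close>.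
\<close>

lemma basis_vector_in_subspace:
  fixes w :: "'i \<Rightarrow>\<^sub>0 'k::field"
  assumes W: "pm.subspace W"
    and diagonal: "\<And>ev v. ev \<in> F \<Longrightarrow> v \<in> W \<Longrightarrow>
      \<exists>u\<in>W. \<forall>k. Poly_Mapping.lookup u k = ev k * Poly_Mapping.lookup v k"
    and "w \<in> W" "w \<noteq> 0"
    and "\<And>i j. i \<in> Poly_Mapping.keys w \<Longrightarrow> j \<in> Poly_Mapping.keys w \<Longrightarrow>
      (\<And>ev. ev \<in> F \<Longrightarrow> ev i = ev j) \<Longrightarrow> i = j"
  shows "\<exists>i\<in>Poly_Mapping.keys w. Poly_Mapping.single i 1 \<in> W"
  using assms(3-)
proof (induction "card (Poly_Mapping.keys w)" arbitrary: w rule: less_induct)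
  case less
  obtain i where i: "i \<in> Poly_Mapping.keys w"
    using less.prems(2) keys_eq_empty by blast
  show ?case
  proof (cases "Poly_Mapping.keys w = {i}")
    case True
    have "Poly_Mapping.lookup w k = 0" if "k \<noteq> i" for k
      using True that by (metis in_keys_iff singletonD)
    moreover have "Poly_Mapping.lookup w i \<noteq> 0"
      using i by (simp add: in_keys_iff)
    ultimately have "Poly_Mapping.single i 1 = pm_scale (inverse (Poly_Mapping.lookup w i)) w"
      by (intro poly_mapping_eqI) (auto simp: lookup_single when_def)
    then have "Poly_Mapping.single i 1 \<in> W"
      using pm.subspace_scale[OF W less.prems(1)] by simp
    then show ?thesis using i by blast
  next
    case False
    then obtain j where j: "j \<in> Poly_Mapping.keys w" "j \<noteq> i"
      using i by blast
    then obtain ev where ev: "ev \<in> F" "ev i \<noteq> ev j"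
      using less.prems(3)[OF i j(1)] by blast
    obtain u where u: "u \<in> W" "\<And>k. Poly_Mapping.lookup u k = ev k * Poly_Mapping.lookup w k"
      using diagonal[OF ev(1) less.prems(1)] by blast
    define w' where "w' = u - pm_scale (ev i) w"
    have w': "Poly_Mapping.lookup w' k = (ev k - ev i) * Poly_Mapping.lookup w k" for k
      by (simp add: w'_def lookup_minus u(2) algebra_simps)
    have j': "j \<in> Poly_Mapping.keys w'"
      using j(1) ev(2) by (simp add: in_keys_iff w')
    have sub: "Poly_Mapping.keys w' \<subseteq> Poly_Mapping.keys w - {i}"
      by (auto simp: in_keys_iff w')
    have "\<exists>i\<in>Poly_Mapping.keys w'. Poly_Mapping.single i 1 \<in> W"
    proof (rule less.hyps)
      show "card (Poly_Mapping.keys w') < card (Poly_Mapping.keys w)"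
        using sub i by (intro psubset_card_mono) auto
      show "w' \<in> W"
        unfolding w'_def by (intro pm.subspace_diff[OF W] u(1) pm.subspace_scale[OF W] less.prems(1))
      show "w' \<noteq> 0" using j' by auto
      show "i1 = i2"
        if "i1 \<in> Poly_Mapping.keys w'" "i2 \<in> Poly_Mapping.keys w'" "\<And>ev. ev \<in> F \<Longrightarrow> ev i1 = ev i2"
        for i1 i2
        using that sub less.prems(3)[of i1 i2] by blast
    qed
    then show ?thesis using sub by blast
  qed
qed

section \<open>Orders of powers of the root of unity\<close>

lemma primitive_root_powi_eq_1_iff:
  assumes l: "3 \<le> l" and q: "primitive_root_of_unity l q"
  shows "q powi n = 1 \<longleftrightarrow> int l dvd n"
proof -
  \<comment> \<open>The values \<open>1\<close> are arbitrary nonzero parameters \<open>\<mu>1, \<mu>2, \<mu>3\<close>, which do not occur here.\<close>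
  have "q powi n = q powi (n mod int l)"
    using q_powi_mod[OF assms, of 1 1 1] by simp
  also have "\<dots> = q ^ nat (n mod int l)"
    using l by (simp add: power_int_def)
  also have "\<dots> = 1 \<longleftrightarrow> nat (n mod int l) = 0"
  proof
    have "nat (n mod int l) < l"
      using l by (simp add: nat_less_iff)
    then show "nat (n mod int l) = 0" if "q ^ nat (n mod int l) = 1"
      using q that unfolding primitive_root_of_unity_def by (metis neq0_conv)
  qed simp
  also have "\<dots> \<longleftrightarrow> int l dvd n"
    using l by (simp add: dvd_eq_mod_eq_0 order_antisym_conv)
  finally show ?thesis .
qed

lemma primitive_root_powi_eq_iff:
  assumes "3 \<le> l" and q: "primitive_root_of_unity l q"
  shows "q powi m = q powi n \<longleftrightarrow> int l dvd m - n"
proof -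
  have "q \<noteq> 0"
    using q by (auto simp: primitive_root_of_unity_def zero_power)
  then have "q powi m = q powi n \<longleftrightarrow> q powi (m - n) = 1"
    by (simp add: power_int_diff)
  then show ?thesis
    by (simp add: primitive_root_powi_eq_1_iff[OF assms])
qed

lemma double_dvd_iff_l_one_dvd: "int l dvd 2 * n \<longleftrightarrow> int (l_one l) dvd n"
proof (cases "even l")
  case True
  then have "int l = 2 * int (l_one l)" by (auto simp: l_one_def)
  then show ?thesis by simp
next
  case False
  then have "coprime (int l) 2" by simp
  then show ?thesis
    using False by (simp add: l_one_def coprime_dvd_mult_right_iff)
qed

lemma mult_order_square:
  assumes l: "3 \<le> l" and q: "primitive_root_of_unity l q"
  shows "mult_order (q\<^sup>2) = l_one l"
proof -
  have pos: "0 < l_one l"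
    using l by (auto simp: l_one_def)
  have iff: "(q\<^sup>2) ^ n = 1 \<longleftrightarrow> l_one l dvd n" for n
  proof -
    have "(q\<^sup>2) ^ n = q powi (2 * int n)"
      by (simp add: power_int_def nat_mult_distrib power_mult)
    then show ?thesis
      by (simp only: primitive_root_powi_eq_1_iff[OF assms] double_dvd_iff_l_one_dvd int_dvd_int_iff)
  qed
  show ?thesis
    unfolding mult_order_def iff
    by (rule Least_equality) (use pos in \<open>auto dest: dvd_imp_le\<close>)
qed

section \<open>Simplicity\<close>

lemma single_eq_M2_basis:
  assumes "(a1, a2) \<in> M2_index l"
  shows "Poly_Mapping.single (a1, a2) 1 = M2_basis l a1 a2"
  using assms by (simp add: M2_basis_def M2_index_def)

context
  fixes l :: nat and q \<mu>1 \<mu>2 \<mu>3 :: "'k::field"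
  assumes l3: "3 \<le> l" and q: "primitive_root_of_unity l q"
    and mu: "\<mu>1 \<noteq> 0" "\<mu>2 \<noteq> 0" "\<mu>3 \<noteq> 0"
begin

abbreviation (input) act where "act \<equiv> M2_free_act l q \<mu>1 \<mu>2 \<mu>3"

text \<open>
  The element whose eigenvalue on \<open>e(a1, a2)\<close> is the one of \<open>X\<close> with \<open>a1\<close> replaced by \<open>- a1\<close>.
  The coefficient of \<open>E Y\<close> cancels the denominator in the action of \<open>E\<close>.
\<close>

definition mirror_X :: "ageing_gen list \<Rightarrow>\<^sub>0 'k" where
  "mirror_X = wd [genX] + pm_scale (q powi (-2) - 1) (wd [genE, genY])"

lemma act_X_basis:
  assumes "0 \<le> a1" "a1 < int (l_one l)"
  shows "act (M2_basis l a1 a2) (wd [genX]) = pm_scale (\<mu>1 * q powi (a2 - a1)) (M2_basis l a1 a2)"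
  using GEN_X[OF l3 q mu assms, of a2] by (simp add: ACT_single)

lemma act_mirror_X_basis:
  assumes a: "0 \<le> a1" "a1 < int (l_one l)"
  shows "act (M2_basis l a1 a2) mirror_X = pm_scale (\<mu>1 * q powi (a2 + a1)) (M2_basis l a1 a2)"
proof -
  note nz = q_nz[OF l3 q mu]
  define D where "D = q powi (-2) - 1"
  have D: "D \<noteq> 0"
    using q2_nz[OF l3 q mu] by (simp add: D_def)
  define c where "c = E_coeff q \<mu>1 \<mu>2 a1 a2 * (\<mu>2 * q powi (- a2))"
  \<comment> \<open>\<open>E\<close> acts first: it kills row \<open>0\<close> and lowers the others, so \<open>Y\<close> never wraps around.\<close>
  have EY: "act (M2_basis l a1 a2) (wd [genE, genY]) = pm_scale c (M2_basis l a1 a2)"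
  proof (cases "a1 = 0")
    case True
    then show ?thesis
      using a by (simp add: c_def ACT_single GEN_E[OF l3 q mu] E_coeff_0[OF l3 q mu])
  next
    case False
    then show ?thesis
      using a by (simp add: c_def ACT_single GEN_E[OF l3 q mu] GEN_Y[OF l3 q mu] lin_ext_scale)
  qed
  define u t where "u = q powi a1" and "t = q powi a2"
  have ut: "u \<noteq> 0" "t \<noteq> 0"
    using nz by (simp_all add: u_def t_def)
  have powers: "q powi (a1 + 2 * a2) = u * t\<^sup>2" "q powi (- 2 * a1) = inverse (u\<^sup>2)"
      "q powi (- a2) = inverse t" "q powi (a2 + a1) = t * u" "q powi (a2 - a1) = t / u"
    using nz power_int_mult[of q a2 2] power_int_mult[of q a1 2]
    by (simp_all add: u_def t_def power_int_add power_int_diff power_int_minus mult.commute)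
  have c: "c = - inverse \<mu>2 * \<mu>1 * (u * t\<^sup>2) * ((inverse (u\<^sup>2) - 1) / D) * (\<mu>2 * inverse t)"
    by (simp only: c_def E_coeff_def[OF l3 q mu] powers D_def [symmetric])
  have "D * c = \<mu>1 * q powi (a2 + a1) - \<mu>1 * q powi (a2 - a1)"
    unfolding powers c using ut mu D by (simp add: power2_eq_square field_simps)
  then have "\<mu>1 * q powi (a2 - a1) + D * c = \<mu>1 * q powi (a2 + a1)"
    by simp
  then show ?thesis
    by (simp add: mirror_X_def ACT_add_right ACT_scale_right EY act_X_basis[OF a] D_def [symmetric]
        pm.scale_left_distrib [symmetric])
qed

lemma act_diagonal:
  assumes ev: "\<And>a1 a2. (a1, a2) \<in> M2_index l \<Longrightarrow>
      act (M2_basis l a1 a2) f = pm_scale (ev (a1, a2)) (M2_basis l a1 a2)"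
    and v: "v \<in> M2_carrier l"
  shows "Poly_Mapping.lookup (act v f) k = ev k * Poly_Mapping.lookup v k"
proof (induction v rule: pm_induct)
  case (single i c)
  then have i: "(fst i, snd i) \<in> M2_index l"
    using v by (auto simp: M2_carrier_def)
  have s: "Poly_Mapping.single i c = pm_scale c (Poly_Mapping.single i 1)"
    by (rule poly_mapping_eqI) (simp add: lookup_single when_def)
  have "act (Poly_Mapping.single i c) f = pm_scale c (pm_scale (ev i) (Poly_Mapping.single i 1))"
    unfolding s ACT_scale_left using ev[OF i] by (simp add: single_eq_M2_basis[OF i, symmetric])
  then show ?case by (simp add: lookup_single when_def)
qed (simp_all add: ACT_zero_left ACT_add_left lookup_add algebra_simps)

text \<open>
  The difference of the exponents \<open>a2 + a1\<close> and \<open>a2 - a1\<close> is \<open>2 * a1\<close>.  It is determined only modulo \<open>l\<close>, but for even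
  \<open>l\<close> the range of \<open>a1\<close> is only half as long, so \<open>a1\<close> is determined in both parities.
\<close>

lemma weights_separate:
  assumes a: "(a1, a2) \<in> M2_index l" and b: "(b1, b2) \<in> M2_index l"
    and X: "q powi (a2 - a1) = q powi (b2 - b1)" and P: "q powi (a2 + a1) = q powi (b2 + b1)"
  shows "a1 = b1 \<and> a2 = b2"
proof -
  have eq: "x = y" if "int n dvd x - y" "0 \<le> x" "x < int n" "0 \<le> y" "y < int n" for n x y
    using that by (simp add: mod_eq_dvd_iff [symmetric])
  have dvd: "int l dvd (a2 - a1) - (b2 - b1)" "int l dvd (a2 + a1) - (b2 + b1)"
    using X P by (simp_all only: primitive_root_powi_eq_iff[OF l3 q])
  from dvd_diff[OF dvd(2,1)] have "int l dvd 2 * (a1 - b1)"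
    by (simp add: algebra_simps)
  then have "int (l_one l) dvd a1 - b1"
    by (simp only: double_dvd_iff_l_one_dvd)
  then have 1: "a1 = b1"
    using a b by (intro eq[of "l_one l"]) (auto simp: M2_index_def)
  then have "a2 = b2"
    using dvd(1) a b by (intro eq[of l]) (auto simp: M2_index_def)
  with 1 show ?thesis ..
qed

text \<open>
  Powers of \<open>K\<close> fill a whole row \<open>{e(a1, a2) | a2}\<close> from one of its vectors.  So it does not matter
  that, for even \<open>l\<close>, \<open>Y\<close> shifts the second index when it goes from
  the top row back to row \<open>0\<close>: it is enough to pass from row to row.
\<close>

lemma basis_vectors_generate:
  assumes W: "pm.subspace W" and act: "\<And>w f. w \<in> W \<Longrightarrow> act w f \<in> W"
    and b: "M2_basis l b1 b2 \<in> W" "0 \<le> b1" "b1 < int (l_one l)"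
    and a: "0 \<le> a1" "a1 < int (l_one l)"
  shows "M2_basis l a1 a2 \<in> W"
proof -
  let ?B = "M2_basis l :: int \<Rightarrow> int \<Rightarrow> 'k M2_vec"
  let ?GEN = "\<lambda>g. lin_ext (M2_gen l q \<mu>1 \<mu>2 \<mu>3 g)"
  note nz = q_nz[OF l3 q mu]
  have gen: "?GEN g w \<in> W" if "w \<in> W" for g w
    using act[OF that, of "wd [g]"] by (simp add: ACT_single)
  have unscale: "v \<in> W" if "pm_scale c v \<in> W" "c \<noteq> 0" for c v
    using pm.subspace_scale[OF W that(1), of "inverse c"] that(2) by simp
  have row: "?B x z \<in> W" if y: "?B x y \<in> W" and x: "0 \<le> x" "x < int (l_one l)" for x y z
  proof -
    have up: "?B x (y + int n) \<in> W" for n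
    proof (induction n)
      case (Suc n)
      then have "pm_scale \<mu>3 (?B x (y + int n + 1)) \<in> W"
        using gen[of "?B x (y + int n)" genK] by (simp add: GEN_K[OF l3 q mu x])
      then show ?case
        using unscale mu(3) by (simp add: ac_simps)
    qed (use y in simp)
    have "(y + int (nat ((z - y) mod int l))) mod int l = z mod int l"
      using l3 by (simp add: mod_simps)
    then have "?B x (y + int (nat ((z - y) mod int l))) = ?B x z"
      by (simp only: M2_basis_def)
    then show ?thesis
      using up[of "nat ((z - y) mod int l)"] by simp
  qed
  have Y: "\<forall>z. ?B (x + 1) z \<in> W" if z: "\<forall>z. ?B x z \<in> W" and x: "0 \<le> x" "x < int (l_one l) - 1" for x
  proof
    fix z
    have "pm_scale (\<mu>2 * q powi (- z)) (?B (x + 1) z) \<in> W"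
      using gen[of "?B x z" genY] z by (simp add: GEN_Y[OF l3 q mu x])
    then show "?B (x + 1) z \<in> W"
      by (rule unscale) (use mu nz in simp)
  qed
  have raise: "\<forall>z. ?B y z \<in> W" if "x \<le> y" "\<forall>z. ?B x z \<in> W" "0 \<le> x" "y < int (l_one l)" for x y
    using that
  proof (induction y rule: int_ge_induct)
    case (step y)
    then show ?case by (intro Y) auto
  qed
  have top: "\<forall>z. ?B (int (l_one l) - 1) z \<in> W"
    by (rule raise[of b1]) (use row[OF b] b in auto)
  obtain s where s: "\<And>z. ?GEN genY (?B (int (l_one l) - 1) z) = pm_scale (\<mu>2 * q powi (- z)) (?B 0 (s + z))"
    by (rule GEN_Y_top[OF l3 q mu]) blast
  have "pm_scale (\<mu>2 * q powi (- 0)) (?B 0 (s + 0)) \<in> W"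
    using gen[of "?B (int (l_one l) - 1) 0" genY] top by (simp only: s)
  then have "?B 0 (s + 0) \<in> W"
    by (rule unscale) (use mu nz in simp)
  then have "\<forall>z. ?B 0 z \<in> W"
    using row[of 0 "s + 0"] l_one_bounds[OF l3 q mu] by simp
  then show ?thesis
    using raise[of 0 a1] a by simp
qed

lemma simple_M2:
  assumes W: "W \<subseteq> M2_carrier l" "pm.subspace W" and act: "\<And>w f. w \<in> W \<Longrightarrow> act w f \<in> W"
  shows "W = {0} \<or> W = M2_carrier l"
proof (cases "W = {0}")
  case False
  then obtain w where w: "w \<in> W" "w \<noteq> 0"
    using pm.subspace_0[OF W(2)] by blast
  define F where "F = {\<lambda>(a1, a2). \<mu>1 * q powi (a2 - a1), \<lambda>(a1, a2). \<mu>1 * q powi (a2 + a1)}"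
  have "\<exists>i\<in>Poly_Mapping.keys w. Poly_Mapping.single i 1 \<in> W"
  proof (rule basis_vector_in_subspace[OF W(2) _ w, of F])
    fix ev v assume ev: "ev \<in> F" and v: "v \<in> W"
    obtain f where "act (M2_basis l a1 a2) f = pm_scale (ev (a1, a2)) (M2_basis l a1 a2)"
      if "(a1, a2) \<in> M2_index l" for a1 a2
    proof -
      consider "ev = (\<lambda>(a1, a2). \<mu>1 * q powi (a2 - a1))" | "ev = (\<lambda>(a1, a2). \<mu>1 * q powi (a2 + a1))"
        using ev unfolding F_def by blast
      then show ?thesis
      proof cases
        case 1
        show ?thesis
          by (rule that[of "wd [genX]"]) (simp add: 1 M2_index_def act_X_basis)
      next
        case 2
        show ?thesis
          by (rule that[of mirror_X]) (simp add: 2 M2_index_def act_mirror_X_basis)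
      qed
    qed
    then have "Poly_Mapping.lookup (act v f) k = ev k * Poly_Mapping.lookup v k" for k
      using v W(1) by (intro act_diagonal) auto
    then show "\<exists>u\<in>W. \<forall>k. Poly_Mapping.lookup u k = ev k * Poly_Mapping.lookup v k"
      using act[OF v] by blast
  next
    fix i j assume ij: "i \<in> Poly_Mapping.keys w" "j \<in> Poly_Mapping.keys w"
      and ev: "\<And>ev. ev \<in> F \<Longrightarrow> ev i = ev j"
    obtain a1 a2 b1 b2 where e: "i = (a1, a2)" "j = (b1, b2)"
      by (cases i; cases j)
    have "(a1, a2) \<in> M2_index l" "(b1, b2) \<in> M2_index l"
      using ij w(1) W(1) by (auto simp: e M2_carrier_def)
    moreover have "q powi (a2 - a1) = q powi (b2 - b1)" "q powi (a2 + a1) = q powi (b2 + b1)"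
      using ev[of "\<lambda>(a1, a2). \<mu>1 * q powi (a2 - a1)"] ev[of "\<lambda>(a1, a2). \<mu>1 * q powi (a2 + a1)"] mu(1)
      by (simp_all add: F_def e)
    ultimately show "i = j"
      using weights_separate by (simp add: e)
  qed
  then obtain b1 b2 where b: "(b1, b2) \<in> M2_index l" "Poly_Mapping.single (b1, b2) 1 \<in> W"
    using w(1) W(1) by (force simp: M2_carrier_def)
  have "(\<lambda>i. Poly_Mapping.single i 1) ` M2_index l \<subseteq> W"
  proof clarify
    fix a1 a2 assume a: "(a1, a2) \<in> M2_index l"
    show "Poly_Mapping.single (a1, a2) 1 \<in> W"
      unfolding single_eq_M2_basis[OF a]
      by (rule basis_vectors_generate[OF W(2) act, of b1 b2])
         (use a b in \<open>auto simp: M2_index_def single_eq_M2_basis [symmetric]\<close>)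
  qed
  from pm.span_minimal[OF this W(2)] show ?thesis
    using W(1) by (auto simp: pm_span_singles M2_carrier_def)
qed simp

lemma right_module_M2:
  "right_module (ageing_algebra q) (ageing_scalar q) pm_scale (M2_carrier l) (M2_act l q \<mu>1 \<mu>2 \<mu>3)"
proof -
  interpret k_algebra "ageing_algebra q" "ageing_scalar q"
    by (rule k_algebra_ageing_algebra)
  note act_class = M2_act_class[OF l3 q mu]
  note subspace = carrier_subspace[OF l3 q mu]
  have closed: "act v f \<in> M2_carrier l" if "v \<in> M2_carrier l" for v f
    by (rule ACT_closed[OF l3 q mu that])
  show ?thesis
  proof unfold_locales
    show "pm.subspace (M2_carrier l :: 'k M2_vec set)" by (rule subspace)
  qed (auto simp: carrier_ageing_algebra ageing_class_ops ageing_scalar_def act_class closed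
      pm.subspace_add[OF subspace] ACT_add_left ACT_add_right ACT_mult ACT_one ACT_scale_right)
qed

end

theorem theorem4p2p1:
  fixes q \<mu>1 \<mu>2 \<mu>3 :: "'k::alg_closed_field" and l l1 :: nat
  assumes "3 \<le> l" and "primitive_root_of_unity l q" and "l1 = mult_order (q\<^sup>2)"
    and "\<mu>1 \<noteq> 0" and "\<mu>2 \<noteq> 0" and "\<mu>3 \<noteq> 0"
  shows "simple_right_module (ageing_algebra q) (ageing_scalar q) pm_scale
           (M2_carrier l) (M2_act l q \<mu>1 \<mu>2 \<mu>3)
       \<and> pm.dim (M2_carrier l :: 'k M2_vec set) = l1 * l"
proof
  note hyps = assms(1,2,4-6)
  interpret right_module "ageing_algebra q" "ageing_scalar q" pm_scale
      "M2_carrier l" "M2_act l q \<mu>1 \<mu>2 \<mu>3"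
    by (rule right_module_M2[OF hyps])
  have "(0, 0) \<in> M2_index l"
    using assms(1) l_one_bounds[OF hyps] by (simp add: M2_index_def)
  then have "Poly_Mapping.single (0, 0) 1 \<in> (M2_carrier l :: 'k M2_vec set)"
    by (simp add: M2_carrier_def)
  moreover have "Poly_Mapping.single (0, 0) 1 \<noteq> (0 :: 'k M2_vec)"
    by (simp add: poly_mapping_eq_iff fun_eq_iff lookup_single when_def)
  ultimately have nonzero: "(M2_carrier l :: 'k M2_vec set) \<noteq> {0}"
    by blast
  show "simple_right_module (ageing_algebra q) (ageing_scalar q) pm_scale
      (M2_carrier l) (M2_act l q \<mu>1 \<mu>2 \<mu>3)"
  proof unfold_locales
    fix W :: "'k M2_vec set" assume "submodule W"
    then have W: "W \<subseteq> M2_carrier l" "pm.subspace W"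
      and act: "\<And>w f. w \<in> W \<Longrightarrow> M2_act l q \<mu>1 \<mu>2 \<mu>3 w (ageing_class q f) \<in> W"
      by (auto simp: submodule_def carrier_ageing_algebra)
    have "M2_free_act l q \<mu>1 \<mu>2 \<mu>3 w f \<in> W" if "w \<in> W" for w f
      using act[OF that, of f] M2_act_class[OF hyps, of w f] that W(1) by auto
    then show "W = {0} \<or> W = M2_carrier l"
      by (rule simple_M2[OF hyps W])
  qed (rule nonzero)
  have "pm.dim (M2_carrier l :: 'k M2_vec set) = card (M2_index l)"
    by (simp add: M2_carrier_def pm_dim_keys_subset)
  then show "pm.dim (M2_carrier l :: 'k M2_vec set) = l1 * l"
    by (simp add: M2_index_def assms(3) mult_order_square[OF hyps(1,2)])
qed

end
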